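(* For $a\ge 0$ and $x\in(0,\infty)$, let $$f_a(x)=\frac{1}{2}\ln(2\pi)-x+\left(x-\frac{1}{2}\right)\ln x-\ln\Gamma(x)+\frac{1}{12}\psi'(x+a).$$ Then the function $f_0$ is completely monotonic on $(0,\infty)$, and for every real $a\ge\frac12$ the function $-f_a$ is completely monotonic on $(0,\infty)$.
   Context: $\Gamma(x)=\int_0^\infty t^{x-1}e^{-t}\,dt$ for $x>0$ is the gamma function, $\psi(x)=\Gamma'(x)/\Gamma(x)$ is the di-gamma function, and $\psi'$ is its derivative (the tri-gamma function). A real function $f$ is completely monotonic on an interval $I$ if it has derivatives of all orders on $I$ and $0\le(-1)^n f^{(n)}(x)<\infty$ for all $x\in I$ and all integers $n\ge0$. *)

theory Defs
  imports "HOL-Analysis.Analysis"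
begin

text \<open>
  The witness \<open>D n\<close> is the \<open>n\<close>-th derivative of \<open>f\<close> on \<open>I\<close>, one-sided at
  an endpoint that belongs to \<open>I\<close>. On an interval with more than one point \<open>D\<close> is uniquely
  determined on \<open>I\<close>; for open \<open>I\<close> it is the iterated \<^const>\<open>deriv\<close>, see
  \<open>completely_monotonic_on_open_iff\<close>.
\<close>

definition completely_monotonic_on :: "real set \<Rightarrow> (real \<Rightarrow> real) \<Rightarrow> bool" where
  "completely_monotonic_on I f \<longleftrightarrow>
     (\<exists>D :: nat \<Rightarrow> real \<Rightarrow> real.
        (\<forall>x\<in>I. D 0 x = f x) \<and>
        (\<forall>n. \<forall>x\<in>I. (D n has_real_derivative D (Suc n) x) (at x within I)) \<and>
        (\<forall>n. \<forall>x\<in>I. 0 \<le> (-1) ^ n * D n x))"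

lemma completely_monotonic_on_open_iff:
  assumes "open I"
  shows "completely_monotonic_on I f \<longleftrightarrow>
    (\<forall>n. \<forall>x\<in>I. (deriv ^^ n) f differentiable (at x) \<and> 0 \<le> (-1) ^ n * (deriv ^^ n) f x)"
proof
  assume "completely_monotonic_on I f"
  then obtain D where D0: "\<And>x. x \<in> I \<Longrightarrow> D 0 x = f x"
    and DS: "\<And>n x. x \<in> I \<Longrightarrow> (D n has_real_derivative D (Suc n) x) (at x within I)"
    and Dn: "\<And>n x. x \<in> I \<Longrightarrow> 0 \<le> (-1) ^ n * D n x"
    unfolding completely_monotonic_on_def by blast
  have step: "((deriv ^^ n) f has_real_derivative D (Suc n) x) (at x)"
    if eq: "\<forall>y\<in>I. (deriv ^^ n) f y = D n y" and x: "x \<in> I" for n x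
  proof (rule has_field_derivative_transform_within_open)
    show "(D n has_real_derivative D (Suc n) x) (at x)"
      using DS[OF x, of n] at_within_open[OF x assms] by simp
  qed (use assms eq x in auto)
  have eq: "\<forall>x\<in>I. (deriv ^^ n) f x = D n x" for n
  proof (induction n)
    case 0
    show ?case using D0 by simp
  next
    case (Suc n)
    show ?case using step[OF Suc] DERIV_imp_deriv by fastforce
  qed
  show "\<forall>n. \<forall>x\<in>I. (deriv ^^ n) f differentiable (at x) \<and> 0 \<le> (-1) ^ n * (deriv ^^ n) f x"
    using step[OF eq] eq Dn by (metis real_differentiable_def)
next
  assume *: "\<forall>n. \<forall>x\<in>I. (deriv ^^ n) f differentiable (at x) \<and>
    0 \<le> (-1) ^ n * (deriv ^^ n) f x"
  show "completely_monotonic_on I f"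
    unfolding completely_monotonic_on_def
  proof (intro exI[of _ "\<lambda>n. (deriv ^^ n) f"] conjI allI ballI)
    fix n x assume x: "x \<in> I"
    have "(deriv ^^ n) f field_differentiable (at x)"
      using * x by (metis real_differentiable_def field_differentiable_def)
    then show "((deriv ^^ n) f has_real_derivative (deriv ^^ Suc n) f x) (at x within I)"
      by (simp add: DERIV_deriv_iff_field_differentiable has_field_derivative_at_within)
  qed (use * in auto)
qed

definition fa :: "real \<Rightarrow> real \<Rightarrow> real" where
  "fa a x = 1/2 * ln (2 * pi) - x + (x - 1/2) * ln x - ln (Gamma x) + 1/12 * Polygamma 1 (x + a)"

text \<open>
  \<^const>\<open>Polygamma\<close> and \<^const>\<open>Gamma\<close> are introduced in the library through series and limits.
  On the positive reals they are the classical functions.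
\<close>

lemma Gamma_eq_integral:
  "(x::real) > 0 \<Longrightarrow> Gamma x = integral {0..} (\<lambda>t. t powr (x - 1) / exp t)"
  using Gamma_integral_real[of x] by (simp add: has_integral_iff)

lemma Digamma_eq_deriv_Gamma:
  assumes "(x::real) > 0"
  shows "Digamma x = deriv Gamma x / Gamma x"
proof -
  have "x \<notin> \<int>\<^sub>\<le>\<^sub>0"
    using assms nonpos_Ints_nonpos by fastforce
  then have "deriv Gamma x = Gamma x * Digamma x"
    by (intro DERIV_imp_deriv has_field_derivative_Gamma)
  with Gamma_real_pos[OF assms] show ?thesis by simp
qed

lemma Polygamma_1_eq_deriv_Digamma:
  assumes "(x::real) > 0"
  shows "Polygamma 1 x = deriv Digamma x"
proof -
  have "x \<notin> \<int>\<^sub>\<le>\<^sub>0"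
    using assms nonpos_Ints_nonpos by fastforce
  from has_field_derivative_Polygamma[OF this, of 0 UNIV] show ?thesis
    by (simp add: DERIV_imp_deriv)
qed

end

theory Submission
  imports Defs "HOL-Real_Asymp.Real_Asymp"
begin

text \<open>
  Because \<open>\<psi>'(x) - \<psi>'(x + 1) = 1/x\<^sup>2\<close> and \<open>\<psi>'''(y) - \<psi>'''(y + 1) = 6/y\<^sup>4\<close>, the second
  derivative of \<open>f\<^sub>a\<close> satisfies
  \<open>f\<^sub>a''(x) - f\<^sub>a''(x + 1) = (1/(x + a)\<^sup>4 - 1/(x\<^sup>2 (x + 1)\<^sup>2)) / 2\<close>.
  This is completely monotonic for \<open>a = 0\<close>, and so is its negative for \<open>a \<ge> 1/2\<close>: factoring the
  differences writes both as sums of products of functions \<open>1/(x + c)\<close>. As all derivatives of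
  \<open>f\<^sub>a''\<close> vanish at infinity, the sign pattern passes from the difference to \<open>f\<^sub>a''\<close>. It descends
  to \<open>f\<^sub>a'\<close> and \<open>f\<^sub>a\<close> because these vanish at infinity as well. For \<open>f\<^sub>a\<close> that is Stirling's formula:
  \<open>f\<^sub>0\<close> decreases, \<open>f\<^sub>1\<^sub>/\<^sub>2\<close> increases and they differ by a null function, so the limit
  exists; Legendre's duplication formula shows that it is \<open>0\<close>.
\<close>

section \<open>Completely monotonic functions\<close>

lemma completely_monotonic_on_cong:
  assumes "completely_monotonic_on I f" "\<And>x. x \<in> I \<Longrightarrow> f x = g x"
  shows "completely_monotonic_on I g"
  using assms unfolding completely_monotonic_on_def by metis

lemma completely_monotonic_on_nonneg:
  assumes "completely_monotonic_on I f" "x \<in> I"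
  shows "0 \<le> f x"
proof -
  from assms(1) obtain D where D0: "\<forall>x\<in>I. D 0 x = f x"
    and Dn: "\<forall>n. \<forall>x\<in>I. 0 \<le> (-1) ^ n * D n x"
    unfolding completely_monotonic_on_def by blast
  show ?thesis using D0 Dn[rule_format, of x 0] assms(2) by simp
qed

lemma completely_monotonic_on_add:
  assumes "completely_monotonic_on I f" "completely_monotonic_on I g"
  shows "completely_monotonic_on I (\<lambda>x. f x + g x)"
proof -
  from assms(1) obtain D where D: "\<forall>x\<in>I. D 0 x = f x"
      "\<forall>n. \<forall>x\<in>I. (D n has_real_derivative D (Suc n) x) (at x within I)"
      "\<forall>n. \<forall>x\<in>I. 0 \<le> (-1) ^ n * D n x"
    unfolding completely_monotonic_on_def by blast
  from assms(2) obtain E where E: "\<forall>x\<in>I. E 0 x = g x"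
      "\<forall>n. \<forall>x\<in>I. (E n has_real_derivative E (Suc n) x) (at x within I)"
      "\<forall>n. \<forall>x\<in>I. 0 \<le> (-1) ^ n * E n x"
    unfolding completely_monotonic_on_def by blast
  show ?thesis unfolding completely_monotonic_on_def
    by (rule exI[of _ "\<lambda>n x. D n x + E n x"])
      (use D E in \<open>auto intro!: DERIV_add simp: distrib_left\<close>)
qed

lemma completely_monotonic_on_cmult:
  assumes "completely_monotonic_on I f" "0 \<le> c"
  shows "completely_monotonic_on I (\<lambda>x. c * f x)"
proof -
  from assms(1) obtain D where D: "\<forall>x\<in>I. D 0 x = f x"
      "\<forall>n. \<forall>x\<in>I. (D n has_real_derivative D (Suc n) x) (at x within I)"
      "\<forall>n. \<forall>x\<in>I. 0 \<le> (-1) ^ n * D n x"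
    unfolding completely_monotonic_on_def by blast
  have "0 \<le> (-1) ^ n * (c * D n x)" if "x \<in> I" for n x
  proof -
    have "0 \<le> c * ((-1) ^ n * D n x)" using D(3) that assms(2) by (intro mult_nonneg_nonneg[of c]) auto
    then show ?thesis by (simp add: mult_ac)
  qed
  then show ?thesis unfolding completely_monotonic_on_def
    by (intro exI[of _ "\<lambda>n x. c * D n x"]) (use D in \<open>auto intro!: DERIV_cmult\<close>)
qed

text \<open>Pascal's rule and an index shift. This is the inductive step of the Leibniz formula: the
  right-hand side is the term-by-term derivative of the \<open>n\<close>-th Leibniz sum when
  \<open>u\<close> and \<open>v\<close> list the derivatives of the two factors.\<close>

lemma leibniz_sum_Suc:
  fixes u v :: "nat \<Rightarrow> 'a :: comm_semiring_1"
  shows "(\<Sum>k\<le>Suc n. of_nat (Suc n choose k) * (u k * v (Suc n - k))) =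
    (\<Sum>k\<le>n. of_nat (n choose k) * (u (Suc k) * v (n - k) + u k * v (Suc (n - k))))"
proof -
  have "(\<Sum>k\<le>Suc n. of_nat (Suc n choose k) * (u k * v (Suc n - k))) =
      u 0 * v (Suc n) + (\<Sum>k\<le>n. of_nat (Suc n choose Suc k) * (u (Suc k) * v (n - k)))"
    by (subst sum.atMost_Suc_shift) simp
  also have "\<dots> = (\<Sum>k\<le>n. of_nat (n choose k) * (u (Suc k) * v (n - k))) +
      (u 0 * v (Suc n) + (\<Sum>k\<le>n. of_nat (n choose Suc k) * (u (Suc k) * v (n - k))))"
    by (simp add: distrib_right sum.distrib add_ac)
  \<comment> \<open>Here \<open>u 0 * v (Suc n)\<close> becomes the term with index
    \<open>0\<close>, and the new top term with index \<open>Suc n\<close> is zero because its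
    binomial coefficient vanishes.\<close>
  also have "u 0 * v (Suc n) + (\<Sum>k\<le>n. of_nat (n choose Suc k) * (u (Suc k) * v (n - k))) =
      (\<Sum>k\<le>Suc n. of_nat (n choose k) * (u k * v (Suc n - k)))"
    by (simp add: sum.atMost_Suc_shift del: sum.atMost_Suc)
  also have "\<dots> = (\<Sum>k\<le>n. of_nat (n choose k) * (u k * v (Suc (n - k))))"
    by (simp add: Suc_diff_le binomial_eq_0)
  finally show ?thesis by (simp add: distrib_left sum.distrib)
qed

text \<open>The witness is the Leibniz sum of the two witnesses. Splitting the sign as
  \<open>(-1) ^ k * (-1) ^ (n - k)\<close> hands each factor its own sign, so every summand is
  nonnegative.\<close>

lemma completely_monotonic_on_mult:
  assumes "completely_monotonic_on I f" "completely_monotonic_on I g"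
  shows "completely_monotonic_on I (\<lambda>x. f x * g x)"
proof -
  from assms(1) obtain D where D: "\<forall>x\<in>I. D 0 x = f x"
      "\<And>n x. x \<in> I \<Longrightarrow> (D n has_real_derivative D (Suc n) x) (at x within I)"
      "\<forall>n. \<forall>x\<in>I. 0 \<le> (-1) ^ n * D n x"
    unfolding completely_monotonic_on_def by blast
  from assms(2) obtain E where E: "\<forall>x\<in>I. E 0 x = g x"
      "\<And>n x. x \<in> I \<Longrightarrow> (E n has_real_derivative E (Suc n) x) (at x within I)"
      "\<forall>n. \<forall>x\<in>I. 0 \<le> (-1) ^ n * E n x"
    unfolding completely_monotonic_on_def by blast
  define P where "P n x = (\<Sum>k\<le>n. of_nat (n choose k) * (D k x * E (n - k) x))" for n x
  have "(P n has_real_derivative P (Suc n) x) (at x within I)" if "x \<in> I" for n x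
  proof -
    have "(P n has_real_derivative (\<Sum>k\<le>n. of_nat (n choose k) *
        (D (Suc k) x * E (n - k) x + D k x * E (Suc (n - k)) x))) (at x within I)"
      unfolding P_def using that
      by (intro DERIV_sum DERIV_cmult)
        (auto intro!: derivative_eq_intros D(2) E(2) simp: mult_ac)
    then show ?thesis
      using leibniz_sum_Suc[of n "\<lambda>k. D k x" "\<lambda>k. E k x"] by (simp add: P_def)
  qed
  moreover have "0 \<le> (-1) ^ n * P n x" if "x \<in> I" for n x
  proof -
    have "(-1) ^ n * P n x =
        (\<Sum>k\<le>n. of_nat (n choose k) * (((-1) ^ k * D k x) * ((-1) ^ (n - k) * E (n - k) x)))"
      unfolding P_def sum_distrib_left
    proof (rule sum.cong)
      fix k assume "k \<in> {..n}"
      then have "(-1 :: real) ^ n = (-1) ^ k * (-1) ^ (n - k)"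
        by (simp flip: power_add)
      then show "(-1) ^ n * (of_nat (n choose k) * (D k x * E (n - k) x)) =
          of_nat (n choose k) * (((-1) ^ k * D k x) * ((-1) ^ (n - k) * E (n - k) x))"
        by (simp add: mult_ac)
    qed simp
    also have "0 \<le> \<dots>"
      using D(3) E(3) that
      by (intro sum_nonneg mult_nonneg_nonneg[of "of_nat _"] mult_nonneg_nonneg[of "_ * D _ x"]) auto
    finally show ?thesis .
  qed
  ultimately show ?thesis unfolding completely_monotonic_on_def
    by (intro exI[of _ P]) (use D(1) E(1) in \<open>auto simp: P_def\<close>)
qed

lemma DERIV_inverse_power_shift:
  fixes x c :: real
  assumes "x + c \<noteq> 0"
  shows "((\<lambda>x. 1 / (x + c) ^ Suc n) has_real_derivative - (real (Suc n) / (x + c) ^ Suc (Suc n)))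
    (at x within S)"
proof -
  have "((\<lambda>x. inverse (x + c)) has_real_derivative - (inverse (x + c) * 1 * inverse (x + c)))
      (at x within S)"
    using assms by (intro DERIV_inverse') (auto intro!: derivative_eq_intros)
  from DERIV_power[OF this, of "Suc n"] show ?thesis
    by (simp add: inverse_eq_divide power_divide mult_ac)
qed

text \<open>These are the building blocks from which both rational differences are assembled by
  sums, products and nonnegative multiples.\<close>

lemma completely_monotonic_on_inverse_shift:
  assumes "0 \<le> c"
  shows "completely_monotonic_on {0<..} (\<lambda>x. 1 / (x + c))"
proof -
  define D :: "nat \<Rightarrow> real \<Rightarrow> real" where "D n x = (-1) ^ n * fact n / (x + c) ^ Suc n" for n x
  have "(D n has_real_derivative D (Suc n) x) (at x within {0<..})" if "0 < x" for n x
  proof -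
    have "x + c \<noteq> 0" using that assms by simp
    then have "((\<lambda>x. (-1) ^ n * fact n * (1 / (x + c) ^ Suc n)) has_real_derivative
        (-1) ^ n * fact n * - (real (Suc n) / (x + c) ^ Suc (Suc n))) (at x within {0<..})"
      by (intro DERIV_cmult DERIV_inverse_power_shift)
    then show ?thesis by (simp add: D_def[abs_def] mult_ac)
  qed
  moreover have "0 \<le> (-1) ^ n * D n x" if "0 < x" for n x
  proof -
    have "(-1) ^ n * D n x = fact n / (x + c) ^ Suc n"
      by (simp add: D_def flip: power_mult_distrib mult.assoc)
    then show ?thesis using that assms by simp
  qed
  ultimately show ?thesis unfolding completely_monotonic_on_def
    by (intro exI[of _ D]) (auto simp: D_def)
qed

section \<open>From a derivative or a unit difference back to the function\<close>

text \<open>Only the sign of \<open>f\<close> itself is new: since \<open>f'\<close> is nonpositive,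
  \<open>f\<close> decreases, and a decreasing function that tends to 0 along \<open>x + m\<close>
  is nonnegative. The higher derivatives come from the witness for \<open>- f'\<close>, shifted by
  one order and negated.\<close>

lemma completely_monotonic_on_antiderivative:
  assumes deriv: "\<And>x. 0 < x \<Longrightarrow> (f has_real_derivative f' x) (at x)"
    and cm: "completely_monotonic_on {0<..} (\<lambda>x. - f' x)"
    and lim: "\<And>x. 0 < x \<Longrightarrow> (\<lambda>m. f (x + real m)) \<longlonglongrightarrow> 0"
  shows "completely_monotonic_on {0<..} f"
proof -
  from cm obtain D where D: "\<forall>x\<in>{0<..}. D 0 x = - f' x"
      "\<forall>n. \<forall>x\<in>{0<..}. (D n has_real_derivative D (Suc n) x) (at x within {0<..})"
      "\<forall>n. \<forall>x\<in>{0<..}. 0 \<le> (-1) ^ n * D n x"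
    unfolding completely_monotonic_on_def by blast
  define E where "E n = (case n of 0 \<Rightarrow> f | Suc k \<Rightarrow> \<lambda>x. - D k x)" for n
  have "(E n has_real_derivative E (Suc n) x) (at x within {0<..})" if x: "0 < x" for n x
  proof (cases n)
    case 0
    have "D 0 x = - f' x" using D(1) x by simp
    then show ?thesis
      using has_field_derivative_at_within[OF deriv[OF x]] by (simp add: E_def 0)
  next
    case (Suc k)
    have "((\<lambda>x. - D k x) has_real_derivative - D (Suc k) x) (at x within {0<..})"
      using D(2) x by (intro DERIV_minus) auto
    then show ?thesis by (simp add: E_def Suc)
  qed
  moreover have "0 \<le> (-1) ^ n * E n x" if x: "0 < x" for n x
  proof (cases n)
    case 0
    have "f (x + real m) \<le> f x" for m
    proof (rule DERIV_nonpos_imp_nonincreasing[of x "x + real m" f])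
      fix y assume "x \<le> y" "y \<le> x + real m"
      then have "0 < y" using x by simp
      then show "\<exists>l. (f has_real_derivative l) (at y) \<and> l \<le> 0"
        using deriv completely_monotonic_on_nonneg[OF cm, of y] by (intro exI[of _ "f' y"]) simp
    qed simp
    then have "0 \<le> f x" by (intro LIMSEQ_le_const2[OF lim[OF x]]) auto
    then show ?thesis by (simp add: E_def 0)
  qed (use D(3) x in \<open>auto simp: E_def\<close>)
  ultimately show ?thesis unfolding completely_monotonic_on_def
    by (intro exI[of _ E] conjI allI ballI) (auto simp: E_def)
qed

text \<open>For fixed \<open>n\<close> and \<open>x\<close> the sign condition on the difference
  makes \<open>(-1) ^ n * D n (x + m)\<close> decreasing in \<open>m\<close>. Its limit is 0, so its
  first value is nonnegative.\<close>

lemma completely_monotonic_on_of_difference: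
  assumes deriv: "\<And>n x. 0 < x \<Longrightarrow> (D n has_real_derivative D (Suc n) x) (at x)"
    and lim: "\<And>n x. 0 < x \<Longrightarrow> (\<lambda>m. D n (x + real m)) \<longlonglongrightarrow> 0"
    and cm: "completely_monotonic_on {0<..} (\<lambda>x. D 0 x - D 0 (x + 1))"
  shows "completely_monotonic_on {0<..} (D 0)"
proof -
  from cm obtain H where H: "\<forall>x\<in>{0<..}. H 0 x = D 0 x - D 0 (x + 1)"
      "\<forall>n. \<forall>x\<in>{0<..}. (H n has_real_derivative H (Suc n) x) (at x within {0<..})"
      "\<forall>n. \<forall>x\<in>{0<..}. 0 \<le> (-1) ^ n * H n x"
    unfolding completely_monotonic_on_def by blast
  \<comment> \<open>The witness \<open>H\<close> is known only to exist; uniqueness of derivatives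
    on the open half-line identifies it with the difference of the given derivatives.\<close>
  have H_eq: "\<forall>x>0. H n x = D n x - D n (x + 1)" for n
  proof (induction n)
    case 0
    show ?case using H(1) by simp
  next
    case (Suc n)
    show ?case
    proof (intro allI impI)
      fix x :: real assume x: "0 < x"
      have "(H n has_real_derivative H (Suc n) x) (at x)"
        using H(2)[rule_format, of x n] x at_within_open[of x "{0<..}"] by simp
      moreover have "((\<lambda>x. D n x - D n (x + 1)) has_real_derivative D (Suc n) x - D (Suc n) (x + 1)) (at x)"
        using x by (intro DERIV_diff DERIV_shift[THEN iffD1] deriv) auto
      then have "(H n has_real_derivative D (Suc n) x - D (Suc n) (x + 1)) (at x)"
        by (rule has_field_derivative_transform_within_open[of _ _ _ "{0<..}"]) (use Suc x in auto)
      ultimately show "H (Suc n) x = D (Suc n) x - D (Suc n) (x + 1)"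
        by (rule DERIV_unique)
    qed
  qed
  have "0 \<le> (-1) ^ n * D n x" if x: "0 < x" for n x
  proof -
    have "decseq (\<lambda>m. (-1) ^ n * D n (x + real m))"
    proof (rule decseq_SucI)
      fix m
      have "0 \<le> (-1) ^ n * (D n (x + real m) - D n (x + real m + 1))"
        using H(3)[rule_format, of "x + real m" n] H_eq[of n] x by simp
      then show "(-1) ^ n * D n (x + real (Suc m)) \<le> (-1) ^ n * D n (x + real m)"
        by (simp add: right_diff_distrib add_ac)
    qed
    moreover have "(\<lambda>m. (-1) ^ n * D n (x + real m)) \<longlonglongrightarrow> 0"
      using tendsto_mult_right_zero[OF lim[OF x]] by blast
    ultimately have "0 \<le> (-1) ^ n * D n (x + real 0)" by (rule decseq_ge)
    then show ?thesis by simp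
  qed
  then show ?thesis unfolding completely_monotonic_on_def
    by (intro exI[of _ D]) (auto intro: has_field_derivative_at_within deriv)
qed

section \<open>The two rational differences\<close>

text \<open>With p = 1/x and q = 1/(x + 1) one has p - q = pq. Hence p^4 - (pq)^2 = p^2 (p + q)(p -
  q) = p^2 (p + q) pq, which is free of subtractions.\<close>

lemma completely_monotonic_on_difference_0:
  "completely_monotonic_on {0<..} (\<lambda>x. 1 / x ^ 4 - 1 / (x\<^sup>2 * (x + 1)\<^sup>2))"
proof -
  \<comment> \<open>The summand \<open>0\<close> gives \<open>?p\<close> the shape required by
    \<open>completely_monotonic_on_inverse_shift\<close>.\<close>
  let ?p = "\<lambda>x::real. 1 / (x + 0)" and ?q = "\<lambda>x::real. 1 / (x + 1)"
  have "completely_monotonic_on {0<..} (\<lambda>x. (?p x * ?p x) * ((?p x + ?q x) * (?p x * ?q x)))"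
    by (intro completely_monotonic_on_mult completely_monotonic_on_add
        completely_monotonic_on_inverse_shift) auto
  then show ?thesis
  proof (rule completely_monotonic_on_cong)
    fix x :: real assume x: "x \<in> {0<..}"
    define p q where "p = ?p x" and "q = ?q x"
    have pq: "p * q = p - q" using x by (simp add: p_def q_def divide_simps)
    have "(p * p) * ((p + q) * (p * q)) = (p * p) * ((p + q) * (p - q))"
      by (simp only: pq)
    also have "\<dots> = p ^ 4 - (p * q)\<^sup>2"
      by (simp add: algebra_simps power2_eq_square power4_eq_xxxx)
    also have "\<dots> = 1 / x ^ 4 - 1 / (x\<^sup>2 * (x + 1)\<^sup>2)"
      by (simp add: p_def q_def power_divide power_mult_distrib)
    finally show "(?p x * ?p x) * ((?p x + ?q x) * (?p x * ?q x)) =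
        1 / x ^ 4 - 1 / (x\<^sup>2 * (x + 1)\<^sup>2)"
      unfolding p_def q_def .
  qed
qed

text \<open>The value s^4 with s = 1/(x + 1/2) is inserted between (pq)^2 and r^4. Since (x + 1/2)^2
  - x(x + 1) = 1/4, the difference pq - s^2 equals pq s^2 / 4; moreover s - r = (a - 1/2) s r.
  Factoring (pq)^2 - s^4 and s^4 - r^4 therefore leaves only nonnegative coefficients.\<close>

lemma completely_monotonic_on_difference_ge_half:
  assumes "1 / 2 \<le> a"
  shows "completely_monotonic_on {0<..} (\<lambda>x. 1 / (x\<^sup>2 * (x + 1)\<^sup>2) - 1 / (x + a) ^ 4)"
proof -
  let ?p = "\<lambda>x::real. 1 / (x + 0)" and ?q = "\<lambda>x::real. 1 / (x + 1)"
  let ?s = "\<lambda>x::real. 1 / (x + 1/2)" and ?r = "\<lambda>x::real. 1 / (x + a)"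
  let ?h = "\<lambda>x. 1/4 * ((?p x * ?q x) * (?s x * ?s x)) * (?p x * ?q x + ?s x * ?s x) +
      (a - 1/2) * (?s x * ?r x) * ((?s x + ?r x) * (?s x * ?s x + ?r x * ?r x))"
  have "completely_monotonic_on {0<..} ?h"
    using assms by (intro completely_monotonic_on_mult completely_monotonic_on_add
        completely_monotonic_on_cmult completely_monotonic_on_inverse_shift) auto
  then show ?thesis
  proof (rule completely_monotonic_on_cong)
    fix x :: real assume "x \<in> {0<..}"
    then have x: "0 < x" by simp
    define p q s r where "p = ?p x" and "q = ?q x" and "s = ?s x" and "r = ?r x"
    have "1 / (x * (x + 1)) - 1 / (x + 1/2)\<^sup>2 = 1/4 / ((x * (x + 1)) * (x + 1/2)\<^sup>2)"
      using x by (subst diff_frac_eq) (simp, simp, simp add: power2_eq_square algebra_simps)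
    then have pq: "1/4 * ((p * q) * (s * s)) = p * q - s * s"
      by (simp add: p_def q_def s_def power2_eq_square)
    have sr: "(a - 1/2) * (s * r) = s - r"
      using x assms by (simp add: s_def r_def divide_simps)
    have "?h x = (p * q - s * s) * (p * q + s * s) + (s - r) * ((s + r) * (s * s + r * r))"
      unfolding pq[symmetric] sr[symmetric] by (simp only: p_def q_def s_def r_def)
    also have "\<dots> = (p * q)\<^sup>2 - r ^ 4"
      by (simp add: algebra_simps power2_eq_square power4_eq_xxxx)
    also have "\<dots> = 1 / (x\<^sup>2 * (x + 1)\<^sup>2) - 1 / (x + a) ^ 4"
      by (simp add: p_def q_def r_def power_divide power_mult_distrib)
    finally show "?h x = 1 / (x\<^sup>2 * (x + 1)\<^sup>2) - 1 / (x + a) ^ 4" .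
  qed
qed

section \<open>Behaviour at infinity\<close>

text \<open>By the recurrence, shifting the argument by \<open>m\<close> removes the first
  \<open>m\<close> terms of the convergent series for \<open>Polygamma n x\<close>; what is left is
  a tail of that series.\<close>

lemma tendsto_Polygamma_plus_of_nat:
  fixes x :: real
  assumes x: "0 < x" and n: "0 < n"
  shows "(\<lambda>m. Polygamma n (x + real m)) \<longlonglongrightarrow> 0"
proof -
  have "(\<lambda>m. \<Sum>k<m. inverse ((x + real k) ^ Suc n)) \<longlonglongrightarrow> (-1) ^ Suc n * Polygamma n x / fact n"
    using Polygamma_LIMSEQ[of x n] x n unfolding sums_def by simp
  then have "(\<lambda>m. Polygamma n x + (-1) ^ n * fact n * (\<Sum>k<m. inverse ((x + real k) ^ Suc n)))
      \<longlonglongrightarrow> Polygamma n x + (-1) ^ n * fact n * ((-1) ^ Suc n * Polygamma n x / fact n)"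
    by (intro tendsto_intros)
  also have "Polygamma n x + (-1) ^ n * fact n * ((-1) ^ Suc n * Polygamma n x / fact n) = 0"
    by (simp flip: power_mult_distrib mult.assoc)
  also have "(\<lambda>m. Polygamma n x + (-1) ^ n * fact n * (\<Sum>k<m. inverse ((x + real k) ^ Suc n))) =
      (\<lambda>m. Polygamma n (x + real m))"
    using x by (subst Polygamma_plus_of_nat) (auto simp: inverse_eq_divide)
  finally show ?thesis .
qed

text \<open>The recurrence turns the limit formula for \<open>Digamma x\<close> into convergence of
  \<open>Digamma (x + m) - ln m\<close> to 0, and \<open>ln m\<close> differs from
  \<open>ln (x + m)\<close> by a null sequence.\<close>

lemma tendsto_Digamma_minus_ln_plus_of_nat:
  fixes x :: real
  assumes x: "0 < x"
  shows "(\<lambda>m. Digamma (x + real m) - ln (x + real m)) \<longlonglongrightarrow> 0"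
proof -
  have "(\<lambda>m. ln (real m) - (\<Sum>k<m. inverse (x + real k))) \<longlonglongrightarrow> Digamma x"
    using Digamma_LIMSEQ[of x] x by simp
  moreover have "(\<lambda>m. ln (real m) - ln (x + real m)) \<longlonglongrightarrow> 0"
    by real_asymp
  ultimately have "(\<lambda>m. Digamma x - (ln (real m) - (\<Sum>k<m. inverse (x + real k))) +
      (ln (real m) - ln (x + real m))) \<longlonglongrightarrow> Digamma x - Digamma x + 0"
    by (intro tendsto_intros)
  also have "(\<lambda>m. Digamma x - (ln (real m) - (\<Sum>k<m. inverse (x + real k))) +
      (ln (real m) - ln (x + real m))) = (\<lambda>m. Digamma (x + real m) - ln (x + real m))"
    using x by (subst Polygamma_plus_of_nat) (auto simp: inverse_eq_divide)
  finally show ?thesis by simp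
qed

text \<open>Provides limits along the reals rather than along \<open>x + m\<close>; the duplication
  argument compares values at \<open>x\<close>, \<open>x + 1/2\<close> and
  \<open>2 * x\<close>.\<close>

lemma antimono_on_bounded_below_tendsto:
  fixes f :: "real \<Rightarrow> real"
  assumes mono: "\<And>x y. 0 < x \<Longrightarrow> x \<le> y \<Longrightarrow> f y \<le> f x"
    and lower: "\<And>x. 1 \<le> x \<Longrightarrow> b \<le> f x"
  obtains c where "(f \<longlongrightarrow> c) at_top"
proof
  have bdd: "bdd_below (f ` {1..})"
    using lower by (intro bdd_belowI[of _ b]) auto
  show "(f \<longlongrightarrow> Inf (f ` {1..})) at_top"
  proof (rule order_tendstoI)
    fix l assume "l < Inf (f ` {1..})"
    then have "l < f x" if "1 \<le> x" for x
      using cInf_lower[OF _ bdd, of "f x"] that by fastforce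
    then show "\<forall>\<^sub>F x in at_top. l < f x"
      by (intro eventually_at_top_linorderI)
  next
    fix u assume "Inf (f ` {1..}) < u"
    then obtain y where y: "1 \<le> y" "f y < u"
      using bdd by (subst (asm) cInf_less_iff) auto
    then have "f x < u" if "y \<le> x" for x
      using mono[of y x] that by fastforce
    then show "\<forall>\<^sub>F x in at_top. f x < u"
      by (rule eventually_at_top_linorderI)
  qed
qed

text \<open>Monotonicity and positivity give existence of the limit; the sequence
  \<open>1 + m\<close> then determines its value.\<close>

lemma tendsto_Polygamma_1_at_top: "(Polygamma 1 \<longlongrightarrow> (0::real)) at_top"
proof -
  obtain c :: real where c: "(Polygamma 1 \<longlongrightarrow> c) at_top"
  proof (rule antimono_on_bounded_below_tendsto[of "Polygamma 1" 0])
    show "Polygamma 1 y \<le> Polygamma 1 x" if "0 < x" "x \<le> y" for x y :: real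
      using Polygamma_real_strict_antimono[of x y 1] that by (cases "x = y") auto
    show "0 \<le> Polygamma 1 x" if "1 \<le> x" for x :: real
      using Polygamma_real_odd_pos[of x 1] that nonpos_Ints_nonpos[of x] by force
  qed
  have "filterlim (\<lambda>m. 1 + real m) at_top sequentially" by real_asymp
  from filterlim_compose[OF c this] tendsto_Polygamma_plus_of_nat[of 1 1] have "c = 0"
    by (intro LIMSEQ_unique) auto
  with c show ?thesis by simp
qed

section \<open>The duplication formula and the Stirling remainder\<close>

text \<open>The complex Legendre formula is restricted to the positive reals, where all factors are
  positive and logarithms can be taken.\<close>

lemma ln_Gamma_real_duplication:
  fixes x :: real
  assumes x: "0 < x"
  shows "ln (Gamma x) + ln (Gamma (x + 1/2)) = (1 - 2 * x) * ln 2 + ln pi / 2 + ln (Gamma (2 * x))"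
proof -
  have "complex_of_real (Gamma x * Gamma (x + 1/2)) =
      Gamma (complex_of_real x) * Gamma (complex_of_real x + 1/2)"
    by (simp flip: Gamma_complex_of_real)
  also have "\<dots> = exp ((1 - 2 * complex_of_real x) * of_real (ln 2)) * of_real (sqrt pi) *
      Gamma (2 * complex_of_real x)"
  proof (rule Gamma_legendre_duplication)
    have "complex_of_real y \<notin> \<int>\<^sub>\<le>\<^sub>0" if "0 < y" for y
      using that nonpos_Ints_nonpos[of y] by (auto simp: of_real_in_nonpos_Ints_iff)
    from this[of x] this[of "x + 1/2"] x
    show "complex_of_real x \<notin> \<int>\<^sub>\<le>\<^sub>0" "complex_of_real x + 1/2 \<notin> \<int>\<^sub>\<le>\<^sub>0" by simp_all
  qed
  also have "\<dots> = complex_of_real (exp ((1 - 2 * x) * ln 2) * sqrt pi * Gamma (2 * x))"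
    by (simp add: exp_of_real[symmetric] flip: Gamma_complex_of_real)
  finally have "Gamma x * Gamma (x + 1/2) = exp ((1 - 2 * x) * ln 2) * sqrt pi * Gamma (2 * x)"
    using of_real_eq_iff by blast
  then have "ln (Gamma x * Gamma (x + 1/2)) = ln (exp ((1 - 2 * x) * ln 2) * sqrt pi * Gamma (2 * x))"
    by simp
  moreover have "ln (Gamma x * Gamma (x + 1/2)) = ln (Gamma x) + ln (Gamma (x + 1/2))"
    using x by (intro ln_mult_pos) auto
  moreover have "ln (exp ((1 - 2 * x) * ln 2) * sqrt pi * Gamma (2 * x)) =
      ln (exp ((1 - 2 * x) * ln 2) * sqrt pi) + ln (Gamma (2 * x))"
    using x by (intro ln_mult_pos) auto
  moreover have "ln (exp ((1 - 2 * x) * ln 2) * sqrt pi) = (1 - 2 * x) * ln 2 + ln pi / 2"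
    by (subst ln_mult_pos) (auto simp: ln_sqrt)
  ultimately show ?thesis by simp
qed

text \<open>The logarithm of Stirling's approximation sqrt(2 pi / x) (x / e)^x, minus the logarithm
  of Gamma.\<close>

definition stirling_remainder :: "real \<Rightarrow> real" where
  "stirling_remainder x = 1/2 * ln (2 * pi) - x + (x - 1/2) * ln x - ln (Gamma x)"

lemma fa_eq: "fa a x = stirling_remainder x + 1/12 * Polygamma 1 (x + a)"
  by (simp add: fa_def stirling_remainder_def)

text \<open>Duplication cancels every Gamma term. The remaining elementary expression tends to 0,
  which later fixes the limit of the remainder.\<close>

lemma stirling_remainder_duplication:
  assumes x: "0 < x"
  shows "stirling_remainder x + stirling_remainder (x + 1/2) - stirling_remainder (2 * x) =
    x * ln (1 + 1 / (2 * x)) - 1/2"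
proof -
  have "ln (1 + 1 / (2 * x)) = ln ((x + 1/2) / x)"
    using x by (intro arg_cong[of _ _ ln]) (simp add: field_simps)
  also have "\<dots> = ln (x + 1/2) - ln x"
    using x by (intro ln_divide_pos) auto
  finally have 1: "ln (1 + 1 / (2 * x)) = ln (x + 1/2) - ln x" .
  have 2: "ln (Gamma (2 * x)) =
      ln (Gamma x) + ln (Gamma (x + 1/2)) - (1 - 2 * x) * ln 2 - ln pi / 2"
    using ln_Gamma_real_duplication[OF x] by simp
  have 3: "ln (2 * x) = ln 2 + ln x" "ln (2 * pi) = ln 2 + ln pi"
    using x by (simp_all add: ln_mult)
  show ?thesis
    unfolding stirling_remainder_def 1 2 3 by (simp add: algebra_simps)
qed

section \<open>Derivatives of \<open>f\<^sub>a\<close>\<close>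

definition fa1 :: "real \<Rightarrow> real \<Rightarrow> real" where
  "fa1 a x = ln x - 1 / (2 * x) - Digamma x + 1/12 * Polygamma 2 (x + a)"

text \<open>The derivative of \<open>fa a\<close> of order \<open>n + 2\<close>, in closed form for
  all \<open>n\<close> at once.\<close>

definition fa2 :: "real \<Rightarrow> nat \<Rightarrow> real \<Rightarrow> real" where
  "fa2 a n x = (-1) ^ n * (fact n / x ^ Suc n + fact (Suc n) / (2 * x ^ Suc (Suc n))) -
     Polygamma (Suc n) x + 1/12 * Polygamma (n + 3) (x + a)"

lemma pos_notin_nonpos_Ints: "0 < (x::real) \<Longrightarrow> x \<notin> \<int>\<^sub>\<le>\<^sub>0"
  using nonpos_Ints_nonpos by fastforce

lemma DERIV_Polygamma_shift:
  assumes "0 < x" "0 \<le> (a::real)"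
  shows "((\<lambda>x. Polygamma n (x + a)) has_real_derivative Polygamma (Suc n) (x + a)) (at x)"
  using has_field_derivative_Polygamma[OF pos_notin_nonpos_Ints, of "x + a" n UNIV] assms
  by (simp add: DERIV_shift)

lemma DERIV_fa:
  assumes "0 < x" "0 \<le> a"
  shows "(fa a has_real_derivative fa1 a x) (at x)"
proof -
  \<comment> \<open>\<open>ln_Gamma\<close> replaces \<open>ln (Gamma x)\<close>: its derivative is
    \<open>Digamma\<close>, and both agree on the positive reals.\<close>
  have "((\<lambda>x. 1/2 * ln (2 * pi) - x + (x - 1/2) * ln x - ln_Gamma x + 1/12 * Polygamma 1 (x + a))
      has_real_derivative fa1 a x) (at x)"
    using assms unfolding fa1_def
    by (auto intro!: derivative_eq_intros DERIV_Polygamma_shift simp: field_simps numeral_2_eq_2)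
  then show ?thesis
    by (rule has_field_derivative_transform_within_open[of _ _ _ "{0<..}"])
      (use assms in \<open>auto simp: fa_def ln_Gamma_real_pos\<close>)
qed

lemma DERIV_fa1:
  assumes "0 < x" "0 \<le> a"
  shows "(fa1 a has_real_derivative fa2 a 0 x) (at x)"
proof -
  \<comment> \<open>The term 1/(2x) is written with \<open>x + 0\<close> and \<open>Suc 0\<close> to
    fit \<open>DERIV_inverse_power_shift\<close>.\<close>
  have "((\<lambda>x. ln x - 1/2 * (1 / (x + 0) ^ Suc 0) - Digamma x + 1/12 * Polygamma 2 (x + a))
      has_real_derivative 1 / x - 1/2 * - (real (Suc 0) / (x + 0) ^ Suc (Suc 0)) -
        Polygamma (Suc 0) x + 1/12 * Polygamma (Suc 2) (x + a)) (at x)"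
    using assms
    by (intro DERIV_add DERIV_diff DERIV_cmult DERIV_ln_divide DERIV_inverse_power_shift
        has_field_derivative_Polygamma DERIV_Polygamma_shift pos_notin_nonpos_Ints) auto
  then show ?thesis by (simp add: fa1_def[abs_def] fa2_def)
qed

lemma DERIV_fa2:
  assumes "0 < x" "0 \<le> a"
  shows "(fa2 a n has_real_derivative fa2 a (Suc n) x) (at x)"
proof -
  have "((\<lambda>x. (-1) ^ n * (fact n * (1 / (x + 0) ^ Suc n) +
        fact (Suc n) / 2 * (1 / (x + 0) ^ Suc (Suc n))) -
        Polygamma (Suc n) x + 1/12 * Polygamma (n + 3) (x + a))
      has_real_derivative
      (-1) ^ n * (fact n * - (real (Suc n) / (x + 0) ^ Suc (Suc n)) +
        fact (Suc n) / 2 * - (real (Suc (Suc n)) / (x + 0) ^ Suc (Suc (Suc n)))) -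
        Polygamma (Suc (Suc n)) x + 1/12 * Polygamma (Suc (n + 3)) (x + a)) (at x)"
    using assms
    by (intro DERIV_add DERIV_diff DERIV_cmult DERIV_inverse_power_shift
        has_field_derivative_Polygamma DERIV_Polygamma_shift pos_notin_nonpos_Ints) auto
  also have "fact n * - (real (Suc n) / (x + 0) ^ Suc (Suc n)) +
        fact (Suc n) / 2 * - (real (Suc (Suc n)) / (x + 0) ^ Suc (Suc (Suc n))) =
      - (fact (Suc n) / x ^ Suc (Suc n) + fact (Suc (Suc n)) / (2 * x ^ Suc (Suc (Suc n))))"
    by (simp add: mult_ac del: power_Suc)
  also have "(-1) ^ n * - y = (-1) ^ Suc n * y" for y :: real
    by simp
  finally have "((\<lambda>x. (-1) ^ n * (fact n * (1 / (x + 0) ^ Suc n) +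
        fact (Suc n) / 2 * (1 / (x + 0) ^ Suc (Suc n))) -
        Polygamma (Suc n) x + 1/12 * Polygamma (n + 3) (x + a))
      has_real_derivative fa2 a (Suc n) x) (at x)"
    by (simp only: fa2_def add_Suc)
  then show ?thesis by (simp add: fa2_def[abs_def])
qed

lemma tendsto_fa1:
  assumes "0 < x" "0 \<le> a"
  shows "(\<lambda>m. fa1 a (x + real m)) \<longlonglongrightarrow> 0"
proof -
  have "(\<lambda>m. 1 / (2 * (x + real m))) \<longlonglongrightarrow> 0" by real_asymp
  then have "(\<lambda>m. - (Digamma (x + real m) - ln (x + real m)) - 1 / (2 * (x + real m)) +
      1/12 * Polygamma 2 ((x + a) + real m)) \<longlonglongrightarrow> - 0 - 0 + 1/12 * 0"
    using assms
    by (intro tendsto_intros tendsto_Digamma_minus_ln_plus_of_nat tendsto_Polygamma_plus_of_nat) auto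
  then show ?thesis by (simp add: fa1_def algebra_simps)
qed

lemma tendsto_fa2:
  assumes "0 < x" "0 \<le> a"
  shows "(\<lambda>m. fa2 a n (x + real m)) \<longlonglongrightarrow> 0"
proof -
  have inv: "(\<lambda>m. 1 / (x + real m)) \<longlonglongrightarrow> 0" by real_asymp
  have pow: "(\<lambda>m. 1 / (x + real m) ^ Suc k) \<longlonglongrightarrow> 0" for k
    using tendsto_power[OF inv, of "Suc k"] by (simp add: power_divide)
  have "(\<lambda>m. (-1) ^ n * (fact n * (1 / (x + real m) ^ Suc n) +
      fact (Suc n) / 2 * (1 / (x + real m) ^ Suc (Suc n))) -
      Polygamma (Suc n) (x + real m) + 1/12 * Polygamma (n + 3) ((x + a) + real m))
      \<longlonglongrightarrow> (-1) ^ n * (fact n * 0 + fact (Suc n) / 2 * 0) - 0 + 1/12 * 0"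
    using assms by (intro tendsto_intros pow tendsto_Polygamma_plus_of_nat) auto
  then show ?thesis by (simp add: fa2_def algebra_simps)
qed

lemma fa2_difference:
  assumes x: "0 < x" and a: "0 \<le> a"
  shows "fa2 a 0 x - fa2 a 0 (x + 1) = 1/2 * (1 / (x + a) ^ 4 - 1 / (x\<^sup>2 * (x + 1)\<^sup>2))"
proof -
  have 1: "Polygamma 1 (x + 1) = Polygamma 1 x - 1 / x\<^sup>2"
    using Polygamma_plus1[of x 1] x by (simp add: power2_eq_square)
  have "Polygamma 3 (x + a + 1) = Polygamma 3 (x + a) - 6 / (x + a) ^ 4"
    using Polygamma_plus1[of "x + a" 3] x a by (simp add: fact_numeral)
  then have 2: "Polygamma 3 (x + 1 + a) = Polygamma 3 (x + a) - 6 / (x + a) ^ 4"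
    by (simp add: add_ac)
  \<comment> \<open>With p - q = pq the left-hand side is pq - (p^2 + q^2)/2 if one linear
    difference p - q is replaced by the product; it equals -(p - q)^2 / 2, and the same identity
    turns this into -(pq)^2 / 2.\<close>
  have 3: "1 / x + 1 / (2 * x\<^sup>2) - 1 / (x + 1) - 1 / (2 * (x + 1)\<^sup>2) - 1 / x\<^sup>2 =
      - (1 / (x\<^sup>2 * (x + 1)\<^sup>2)) / 2"
  proof -
    define p q where "p = 1 / x" and "q = 1 / (x + 1)"
    have pq: "p * q = p - q" using x by (simp add: p_def q_def divide_simps)
    have eqs: "1 / x = p" "1 / (x + 1) = q" "1 / x\<^sup>2 = p\<^sup>2" "1 / (2 * x\<^sup>2) = p\<^sup>2 / 2"
      "1 / (2 * (x + 1)\<^sup>2) = q\<^sup>2 / 2" "1 / (x\<^sup>2 * (x + 1)\<^sup>2) = (p * q)\<^sup>2"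
      by (simp_all add: p_def q_def power_divide power_mult_distrib)
    have "p + p\<^sup>2 / 2 - q - q\<^sup>2 / 2 - p\<^sup>2 = p * q - (p\<^sup>2 + q\<^sup>2) / 2"
      unfolding pq by (simp add: add_divide_distrib)
    also have "\<dots> = - (p - q)\<^sup>2 / 2" by (simp add: power2_eq_square algebra_simps)
    also have "\<dots> = - (p * q)\<^sup>2 / 2" by (simp only: pq)
    finally show ?thesis unfolding eqs by simp
  qed
  have "fa2 a 0 x - fa2 a 0 (x + 1) =
      (1 / x + 1 / (2 * x\<^sup>2) - 1 / (x + 1) - 1 / (2 * (x + 1)\<^sup>2) - 1 / x\<^sup>2) + 1/2 * (1 / (x + a) ^ 4)"
    using 1 2 by (simp add: fa2_def power2_eq_square diff_divide_distrib)
  then show ?thesis unfolding 3 by (simp add: algebra_simps)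
qed

section \<open>Sign pattern of the first derivative\<close>

text \<open>The factor \<epsilon> lets one argument serve both cases: 1 for \<open>a = 0\<close> and
  -1 for \<open>a \<ge> 1/2\<close>. The sign pattern passes from the unit difference to the second
  derivative, and from there to the first.\<close>

lemma completely_monotonic_on_fa1:
  assumes a: "0 \<le> a"
    and cm: "completely_monotonic_on {0<..} (\<lambda>x. \<epsilon> * (1 / (x + a) ^ 4 - 1 / (x\<^sup>2 * (x + 1)\<^sup>2)))"
  shows "completely_monotonic_on {0<..} (\<lambda>x. - (\<epsilon> * fa1 a x))"
proof (rule completely_monotonic_on_antiderivative)
  show "((\<lambda>x. - (\<epsilon> * fa1 a x)) has_real_derivative - (\<epsilon> * fa2 a 0 x)) (at x)" if "0 < x" for x
    using DERIV_fa1[OF that a] by (intro DERIV_minus DERIV_cmult)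
  show "(\<lambda>m. - (\<epsilon> * fa1 a (x + real m))) \<longlonglongrightarrow> 0" if "0 < x" for x
    using tendsto_mult[OF tendsto_const[of "- \<epsilon>"] tendsto_fa1[OF that a]] by simp
  have "completely_monotonic_on {0<..} (\<lambda>x. \<epsilon> * fa2 a 0 x)"
  proof (rule completely_monotonic_on_of_difference[of "\<lambda>n x. \<epsilon> * fa2 a n x"])
    show "((\<lambda>x. \<epsilon> * fa2 a n x) has_real_derivative \<epsilon> * fa2 a (Suc n) x) (at x)"
      if "0 < x" for n x
      using DERIV_fa2[OF that a] by (intro DERIV_cmult)
    show "(\<lambda>m. \<epsilon> * fa2 a n (x + real m)) \<longlonglongrightarrow> 0" if "0 < x" for n x
      using tendsto_mult[OF tendsto_const[of \<epsilon>] tendsto_fa2[OF that a]] by simp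
    have "completely_monotonic_on {0<..}
        (\<lambda>x. 1/2 * (\<epsilon> * (1 / (x + a) ^ 4 - 1 / (x\<^sup>2 * (x + 1)\<^sup>2))))"
      using cm by (rule completely_monotonic_on_cmult) simp
    then show "completely_monotonic_on {0<..} (\<lambda>x. \<epsilon> * fa2 a 0 x - \<epsilon> * fa2 a 0 (x + 1))"
    proof (rule completely_monotonic_on_cong)
      fix x :: real assume "x \<in> {0<..}"
      then have "\<epsilon> * fa2 a 0 x - \<epsilon> * fa2 a 0 (x + 1) =
          \<epsilon> * (1/2 * (1 / (x + a) ^ 4 - 1 / (x\<^sup>2 * (x + 1)\<^sup>2)))"
        using fa2_difference[of x a] a by (simp only: right_diff_distrib[symmetric] greaterThan_iff)
      then show "1/2 * (\<epsilon> * (1 / (x + a) ^ 4 - 1 / (x\<^sup>2 * (x + 1)\<^sup>2))) =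
          \<epsilon> * fa2 a 0 x - \<epsilon> * fa2 a 0 (x + 1)"
        by (simp only: mult.left_commute)
    qed
  qed
  then show "completely_monotonic_on {0<..} (\<lambda>x. - (- (\<epsilon> * fa2 a 0 x)))" by simp
qed

lemma completely_monotonic_on_fa1_0: "completely_monotonic_on {0<..} (\<lambda>x. - fa1 0 x)"
  using completely_monotonic_on_fa1[of 0 1] completely_monotonic_on_difference_0 by simp

lemma completely_monotonic_on_fa1_ge_half:
  "1 / 2 \<le> a \<Longrightarrow> completely_monotonic_on {0<..} (fa1 a)"
  using completely_monotonic_on_fa1[of a "-1"] completely_monotonic_on_difference_ge_half[of a]
  by simp

section \<open>The limit at infinity\<close>

lemma fa_0_antimono:
  assumes "0 < x" "x \<le> y"
  shows "fa 0 y \<le> fa 0 x"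
proof (rule DERIV_nonpos_imp_nonincreasing[of x y "fa 0"])
  fix z assume "x \<le> z"
  then show "\<exists>l. (fa 0 has_real_derivative l) (at z) \<and> l \<le> 0"
    using assms(1) DERIV_fa[of z 0] completely_monotonic_on_nonneg[OF completely_monotonic_on_fa1_0, of z]
    by (intro exI[of _ "fa1 0 z"]) auto
qed (fact assms(2))

lemma fa_half_mono:
  assumes "0 < x" "x \<le> y"
  shows "fa (1/2) x \<le> fa (1/2) y"
proof (rule DERIV_nonneg_imp_nondecreasing[of x y "fa (1/2)"])
  fix z assume "x \<le> z"
  then show "\<exists>l. (fa (1/2) has_real_derivative l) (at z) \<and> 0 \<le> l"
    using assms(1) DERIV_fa[of z "1/2"]
      completely_monotonic_on_nonneg[OF completely_monotonic_on_fa1_ge_half[of "1/2"], of z]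
    by (intro exI[of _ "fa1 (1/2) z"]) auto
qed (fact assms(2))

lemma tendsto_stirling_remainder: "(stirling_remainder \<longlongrightarrow> 0) at_top"
proof -
  obtain c where c: "(fa 0 \<longlongrightarrow> c) at_top"
  \<comment> \<open>The bound \<open>fa (1/2) 1\<close> works on arguments from 1 on because
    \<open>fa (1/2)\<close> increases and lies below \<open>fa 0\<close>, the tri-gamma function
    being decreasing.\<close>
  proof (rule antimono_on_bounded_below_tendsto[of "fa 0" "fa (1/2) 1"])
    show "fa 0 y \<le> fa 0 x" if "0 < x" "x \<le> y" for x y
      using that by (rule fa_0_antimono)
    show "fa (1/2) 1 \<le> fa 0 x" if "1 \<le> x" for x
    proof -
      have "fa (1/2) 1 \<le> fa (1/2) x" using that by (intro fa_half_mono) auto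
      also have "\<dots> \<le> fa 0 x"
        using Polygamma_real_strict_antimono[of x "x + 1/2" 1] that by (simp add: fa_eq)
      finally show ?thesis .
    qed
  qed
  have "((\<lambda>x. fa 0 x - 1/12 * Polygamma 1 x) \<longlongrightarrow> c - 1/12 * 0) at_top"
    by (intro tendsto_intros c tendsto_Polygamma_1_at_top)
  then have S: "(stirling_remainder \<longlongrightarrow> c) at_top"
    by (simp add: fa_eq)
  have "filterlim (\<lambda>x::real. x + 1/2) at_top at_top" "filterlim (\<lambda>x::real. 2 * x) at_top at_top"
    by real_asymp+
  from S this[THEN filterlim_compose[OF S]]
  have "((\<lambda>x. stirling_remainder x + stirling_remainder (x + 1/2) - stirling_remainder (2 * x))
      \<longlongrightarrow> c + c - c) at_top"
    by (intro tendsto_add tendsto_diff)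
  moreover have "((\<lambda>x. stirling_remainder x + stirling_remainder (x + 1/2) -
      stirling_remainder (2 * x)) \<longlongrightarrow> 0) at_top"
  proof (rule Lim_transform_eventually)
    show "((\<lambda>x::real. x * ln (1 + 1 / (2 * x)) - 1/2) \<longlongrightarrow> 0) at_top" by real_asymp
    show "\<forall>\<^sub>F x in at_top. x * ln (1 + 1 / (2 * x)) - 1/2 =
        stirling_remainder x + stirling_remainder (x + 1/2) - stirling_remainder (2 * x)"
      using eventually_gt_at_top[of 0]
      by eventually_elim (simp only: stirling_remainder_duplication)
  qed
  \<comment> \<open>The unknown limit survives exactly once in the duplication combination, so the
    limit 0 of that combination forces \<open>c = 0\<close>.\<close>
  ultimately have "c + c - c = 0"
    by (rule tendsto_unique[rotated]) simp
  with S show ?thesis by simp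
qed

lemma tendsto_fa: "(\<lambda>m. fa a (x + real m)) \<longlonglongrightarrow> 0"
proof -
  have "filterlim (\<lambda>m. x + real m) at_top sequentially"
    "filterlim (\<lambda>m. x + real m + a) at_top sequentially" by real_asymp+
  from filterlim_compose[OF tendsto_stirling_remainder this(1)]
    filterlim_compose[OF tendsto_Polygamma_1_at_top this(2)]
  have "(\<lambda>m. stirling_remainder (x + real m) + 1/12 * Polygamma 1 (x + real m + a))
      \<longlonglongrightarrow> 0 + 1/12 * 0"
    by (intro tendsto_add tendsto_mult_left)
  then show ?thesis by (simp add: fa_eq)
qed

theorem theorem2p1:
  shows "completely_monotonic_on {0<..} (fa 0) \<and>
    (\<forall>a::real. a \<ge> 1/2 \<longrightarrow> completely_monotonic_on {0<..} (\<lambda>x. - fa a x))"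
proof (intro conjI allI impI)
  show "completely_monotonic_on {0<..} (fa 0)"
    by (rule completely_monotonic_on_antiderivative[OF DERIV_fa completely_monotonic_on_fa1_0 tendsto_fa])
      simp_all
next
  fix a :: real assume a: "a \<ge> 1/2"
  show "completely_monotonic_on {0<..} (\<lambda>x. - fa a x)"
  proof (rule completely_monotonic_on_antiderivative)
    show "((\<lambda>x. - fa a x) has_real_derivative - fa1 a x) (at x)" if "0 < x" for x
      using DERIV_fa[of x a] that a by (intro DERIV_minus) simp
    show "completely_monotonic_on {0<..} (\<lambda>x. - (- fa1 a x))"
      using completely_monotonic_on_fa1_ge_half[OF a] by simp
    show "(\<lambda>m. - fa a (x + real m)) \<longlonglongrightarrow> 0" for x
      using tendsto_minus[OF tendsto_fa] by simp
  qed
qed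

end
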